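(* Let $M, N$ be positive integers, let $X \subseteq \mathbb{Z}^N$ be a finite, nonempty set with cardinality $|X|$, and let $0 < \varepsilon < 1$. Then the inequality $$\sum_{\substack{\xi \in X\\ \xi \ne 0}} F(A\xi) \le 8^M \varepsilon^{-1} |X| \sum_{m=0}^M \frac{\bigl(\log (\varepsilon^{-1}|X|)\bigr)^m}{m!}$$ holds at all points $A$ in $G_1 = (\mathbb{R}/\mathbb{Z})^{MN}$ outside a set of $\mu_1$-measure at most $\varepsilon$.
   Context: For $x \in \mathbb{R}/\mathbb{Z}$, $\|x\|$ is the distance from (any real representative of) $x$ to the nearest integer. Elements of $G_1 = (\mathbb{R}/\mathbb{Z})^{MN}$ are written as $M\times N$ matrices $A = (\alpha_{mn})$ with entries in $\mathbb{R}/\mathbb{Z}$, and $\mu_1$ is the Haar measure on the Borel subsets of $G_1$ normalized so that $\mu_1(G_1)=1$. Elements of $G_2 = (\mathbb{R}/\mathbb{Z})^M$ are written as column vectors. For a column vector $\xi \in \mathbb{Z}^N$, $A\xi = \bigl(\sum_{n=1}^N \alpha_{mn}\xi_n\bigr)_{1\le m\le M} \in G_2$. The function $F : G_2 \to [1,\infty]$ is $$F(x) = \prod_{m=1}^M (2\|x_m\|)^{-1},$$ with value $+\infty$ if some $\|x_m\|=0$. *)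

theory Defs
  imports "HOL-Analysis.Analysis"
begin

section \<open>The circle group R/Z\<close>

quotient_type circle = real / "\<lambda>x y. x - y \<in> (\<int> :: real set)"
proof (rule equivpI)
  show "reflp (\<lambda>x y. x - y \<in> (\<int> :: real set))"
    by (simp add: reflp_def)
  show "symp (\<lambda>x y. x - y \<in> (\<int> :: real set))"
    unfolding symp_def by (metis Ints_minus minus_diff_eq)
  show "transp (\<lambda>x y. x - y \<in> (\<int> :: real set))"
  proof (rule transpI)
    fix x y z :: real
    assume "x - y \<in> \<int>" "y - z \<in> \<int>"
    then have "(x - y) + (y - z) \<in> \<int>" by (rule Ints_add)
    then show "x - z \<in> \<int>" by simp
  qed
qed

instantiation circle :: ab_group_add
begin

lift_definition zero_circle :: circle is "0 :: real" .

lift_definition plus_circle :: "circle \<Rightarrow> circle \<Rightarrow> circle" is "(+) :: real \<Rightarrow> real \<Rightarrow> real"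
proof -
  fix a b c d :: real
  assume "a - b \<in> \<int>" "c - d \<in> \<int>"
  then have "(a - b) + (c - d) \<in> \<int>" by (rule Ints_add)
  then show "(a + c) - (b + d) \<in> \<int>" by (simp add: algebra_simps)
qed

lift_definition uminus_circle :: "circle \<Rightarrow> circle" is "uminus :: real \<Rightarrow> real"
  by (metis Ints_minus minus_diff_eq minus_diff_minus)

lift_definition minus_circle :: "circle \<Rightarrow> circle \<Rightarrow> circle" is "(-) :: real \<Rightarrow> real \<Rightarrow> real"
proof -
  fix a b c d :: real
  assume "a - b \<in> \<int>" "c - d \<in> \<int>"
  then have "(a - b) - (c - d) \<in> \<int>" by (rule Ints_diff)
  then show "(a - c) - (b - d) \<in> \<int>" by (simp add: algebra_simps)
qed

instance
  by standard (transfer, simp)+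

end

lift_definition to_circle :: "real \<Rightarrow> circle" is "\<lambda>x. x" .

lemma to_circle_eq_iff: "to_circle x = to_circle y \<longleftrightarrow> x - y \<in> \<int>"
  by transfer simp

lemma to_circle_add: "to_circle (x + y) = to_circle x + to_circle y"
  by transfer simp

lemma to_circle_surj: "\<exists>x. to_circle x = a"
  by transfer (metis cancel_comm_monoid_add_class.diff_cancel Ints_0)

text \<open>The quotient topology.\<close>

instantiation circle :: topological_space
begin

definition open_circle :: "circle set \<Rightarrow> bool" where
  "open_circle U \<longleftrightarrow> open (to_circle -` U)"

instance
proof
  fix K :: "circle set set"
  assume "\<forall>U\<in>K. open U"
  then show "open (\<Union>K)"
    by (auto simp: open_circle_def vimage_Union)
qed (auto simp: open_circle_def)

end

lift_definition circle_scale :: "int \<Rightarrow> circle \<Rightarrow> circle" is "\<lambda>k x. of_int k * x"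
proof -
  fix k :: int and x y :: real
  assume "x - y \<in> \<int>"
  then have "of_int k * (x - y) \<in> \<int>" by (intro Ints_mult) auto
  then show "of_int k * x - of_int k * y \<in> \<int>" by (simp add: algebra_simps)
qed

lift_definition circle_norm :: "circle \<Rightarrow> real" is "\<lambda>x. infdist x \<int>"
proof -
  have le: "infdist x \<int> \<le> infdist y \<int>" if "x - y \<in> \<int>" for x y :: real
  proof -
    have ne: "(\<int> :: real set) \<noteq> {}" using Ints_0 by blast
    have "infdist x \<int> \<le> dist y k" if k: "k \<in> \<int>" for k
    proof -
      have "k + (x - y) \<in> \<int>" using k \<open>x - y \<in> \<int>\<close> by (rule Ints_add)
      then have "infdist x \<int> \<le> dist x (k + (x - y))" by (rule infdist_le)
      also have "\<dots> = dist y k" by (simp add: dist_real_def)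
      finally show ?thesis .
    qed
    then show ?thesis
      unfolding infdist_notempty[OF ne, of y] by (intro cINF_greatest[OF ne])
  qed
  show "infdist x \<int> = infdist y \<int>" if "x - y \<in> \<int>" for x y :: real
    using le[of x y] le[of y x] that Ints_minus[OF that] by simp
qed

section \<open>Matrices, the product function, and Haar measure\<close>

text \<open>As in the library, an M by N matrix has type \<open>circle^'n^'m\<close> (\<open>CARD('m) = M\<close> rows,
  \<open>CARD('n) = N\<close> columns), and carries the product topology and the entrywise group structure.\<close>

definition mat_apply :: "circle^'n^'m \<Rightarrow> int^'n \<Rightarrow> circle^'m" where
  "mat_apply A \<xi> = (\<chi> m. \<Sum>n\<in>UNIV. circle_scale (\<xi> $ n) (A $ m $ n))"

text \<open>In \<open>ennreal\<close> we have \<open>inverse 0 = \<infinity>\<close>, and no factor below vanishes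
  (\<open>circle_norm\<close> is at most 1/2), so the value is \<open>\<infinity>\<close> as soon as one coordinate is 0.\<close>

definition prodF :: "circle^'m \<Rightarrow> ennreal" where
  "prodF x = (\<Prod>m\<in>UNIV. inverse (ennreal (2 * circle_norm (x $ m))))"

text \<open>Regularity need not be required, since the group is compact and metrizable.\<close>

definition normalized_haar :: "(circle^'n^'m) measure \<Rightarrow> bool" where
  "normalized_haar \<mu> \<longleftrightarrow>
     sets \<mu> = sets borel \<and>
     emeasure \<mu> UNIV = 1 \<and>
     (\<forall>G. \<forall>B\<in>sets borel. emeasure \<mu> ((\<lambda>A. G + A) ` B) = emeasure \<mu> B)"

section \<open>Existence of the Haar measure\<close>

lemma lborel_periodic:
  fixes S :: "'a::euclidean_space set" and t :: 'a
  defines "Q \<equiv> {x :: 'a. \<forall>b\<in>Basis. 0 \<le> x \<bullet> b \<and> x \<bullet> b < 1}"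
  assumes S: "S \<in> sets borel"
    and per: "\<And>x k. (\<forall>b\<in>Basis. k \<bullet> b \<in> \<int>) \<Longrightarrow> x + k \<in> S \<longleftrightarrow> x \<in> S"
  shows "emeasure lborel ((\<lambda>x. x + t) -` S \<inter> Q) = emeasure lborel (S \<inter> Q)"
proof -
  define L where "L = {k :: 'a. \<forall>b\<in>Basis. k \<bullet> b \<in> \<int>}"
  have Qb[measurable]: "Q \<in> sets borel"
    unfolding Q_def by measurable
  have shift: "emeasure lborel ((\<lambda>x. x + v) -` B) = emeasure lborel B"
    if "B \<in> sets borel" for v and B :: "'a set"
  proof -
    have "emeasure lborel B = emeasure (distr lborel borel ((+) v)) B"
      by (simp add: lborel_distr_plus)
    also have "\<dots> = emeasure lborel ((+) v -` B \<inter> space lborel)"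
      using that by (intro emeasure_distr) auto
    finally show ?thesis by (simp add: vimage_def add.commute[of v])
  qed
  have cL: "countable L"
  proof -
    have "countable (PiE (Basis :: 'a set) (\<lambda>_. \<int> :: real set))"
      by (intro countable_PiE) (auto simp: Ints_def)
    then have "countable ((\<lambda>f. \<Sum>b\<in>Basis. f b *\<^sub>R b) ` PiE (Basis :: 'a set) (\<lambda>_. \<int> :: real set))"
      by (rule countable_image)
    moreover have "k \<in> (\<lambda>f. \<Sum>b\<in>Basis. f b *\<^sub>R b) ` PiE (Basis :: 'a set) (\<lambda>_. \<int> :: real set)"
      if "k \<in> L" for k
    proof (rule image_eqI)
      show "k = (\<Sum>b\<in>Basis. (restrict (\<lambda>b. k \<bullet> b) Basis) b *\<^sub>R b)"
        by (simp add: euclidean_representation)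
      show "restrict (\<lambda>b. k \<bullet> b) Basis \<in> PiE (Basis :: 'a set) (\<lambda>_. \<int> :: real set)"
        using that by (auto simp: L_def)
    qed
    ultimately show ?thesis by (meson countable_subset subsetI)
  qed
  have frac: "\<exists>k\<in>L. x - k \<in> Q" for x :: 'a
    by (intro bexI[of _ "\<Sum>b\<in>Basis. of_int \<lfloor>x \<bullet> b\<rfloor> *\<^sub>R b"])
      (auto simp: L_def Q_def inner_diff_left inner_sum_left_Basis, linarith+)
  have uniq: "k = l" if "k \<in> L" "l \<in> L" "x - k \<in> Q" "x - l \<in> Q" for x k l
  proof (rule euclidean_eqI)
    fix b :: 'a assume b: "b \<in> Basis"
    have "k \<bullet> b \<in> \<int>" using that b by (simp add: L_def)
    then obtain i where i: "k \<bullet> b = of_int i" by (rule Ints_cases)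
    have "l \<bullet> b \<in> \<int>" using that b by (simp add: L_def)
    then obtain j where j: "l \<bullet> b = of_int j" by (rule Ints_cases)
    have "0 \<le> x \<bullet> b - i" "x \<bullet> b - i < 1" "0 \<le> x \<bullet> b - j" "x \<bullet> b - j < 1"
      using that b i j by (auto simp: Q_def inner_diff_left)
    then have "i = j" by linarith
    then show "k \<bullet> b = l \<bullet> b" by (simp add: i j)
  qed
  define T where "T k = {x. x - k \<in> Q}" for k
  have Tb[measurable]: "T k \<in> sets borel" for k
    unfolding T_def by measurable
  have decomp: "emeasure lborel B = (\<integral>\<^sup>+k. emeasure lborel (B \<inter> T k) \<partial>count_space L)"
    if "B \<in> sets borel" for B
  proof -
    have "B = (\<Union>k\<in>L. B \<inter> T k)" using frac by (auto simp: T_def)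
    moreover have "disjoint_family_on (\<lambda>k. B \<inter> T k) L"
      using uniq by (auto simp: disjoint_family_on_def T_def)
    ultimately show ?thesis
      using emeasure_UN_countable[OF _ cL, of "\<lambda>k. B \<inter> T k" lborel] that by auto
  qed
  define Q' where "Q' = {x. x - t \<in> Q}"
  have [measurable]: "Q' \<in> sets borel" unfolding Q'_def by measurable
  have Lm: "- k \<in> L \<longleftrightarrow> k \<in> L" for k by (auto simp: L_def)
  note S[measurable]
  have "emeasure lborel ((\<lambda>x. x + t) -` S \<inter> Q) = emeasure lborel ((\<lambda>x. x + t) -` (S \<inter> Q'))"
    by (intro arg_cong[of _ _ "emeasure lborel"]) (auto simp: Q'_def)
  also have "\<dots> = emeasure lborel (S \<inter> Q')"
    by (intro shift) measurable
  also have "\<dots> = (\<integral>\<^sup>+k. emeasure lborel (S \<inter> Q' \<inter> T k) \<partial>count_space L)"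
    by (intro decomp) measurable
  also have "\<dots> = (\<integral>\<^sup>+k. emeasure lborel (S \<inter> Q \<inter> {x. x + k \<in> Q'}) \<partial>count_space L)"
  proof (intro nn_integral_cong)
    fix k assume "k \<in> space (count_space L)"
    then have k: "k \<in> L" by simp
    have "emeasure lborel (S \<inter> Q' \<inter> T k) = emeasure lborel ((\<lambda>x. x + k) -` (S \<inter> Q' \<inter> T k))"
      by (intro shift[symmetric]) measurable
    also have "(\<lambda>x. x + k) -` (S \<inter> Q' \<inter> T k) = S \<inter> Q \<inter> {x. x + k \<in> Q'}"
      using k per by (auto simp: T_def L_def)
    finally show "emeasure lborel (S \<inter> Q' \<inter> T k) = emeasure lborel (S \<inter> Q \<inter> {x. x + k \<in> Q'})" .
  qed
  also have "\<dots> = emeasure lborel (S \<inter> Q)"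
  proof -
    have "S \<inter> Q = (\<Union>k\<in>L. S \<inter> Q \<inter> {x. x + k \<in> Q'})"
    proof -
      have "\<exists>k\<in>L. x + k \<in> Q'" for x
        using frac[of "x - t"] Lm by (force simp: Q'_def algebra_simps)
      then show ?thesis by auto
    qed
    moreover have "disjoint_family_on (\<lambda>k. S \<inter> Q \<inter> {x. x + k \<in> Q'}) L"
    proof -
      have "k = l" if "k \<in> L" "l \<in> L" "x + k \<in> Q'" "x + l \<in> Q'" for x k l
        using uniq[of "-k" "-l" "x - t"] that Lm by (simp add: Q'_def algebra_simps)
      then show ?thesis by (auto simp: disjoint_family_on_def)
    qed
    moreover have "S \<inter> Q \<inter> {x. x + k \<in> Q'} \<in> sets lborel" for k
      by measurable
    ultimately show ?thesis
      using emeasure_UN_countable[OF _ cL, of "\<lambda>k. S \<inter> Q \<inter> {x. x + k \<in> Q'}" lborel] by auto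
  qed
  finally show ?thesis .
qed

lemma continuous_to_circle: "continuous_on UNIV to_circle"
  by (subst continuous_on_open_vimage) (simp_all add: open_circle_def)

lemma continuous_circle_add: "continuous_on UNIV (\<lambda>x :: circle. g + x)"
proof -
  obtain r where r: "to_circle r = g" using to_circle_surj by blast
  have "open ((\<lambda>x. g + x) -` U)" if "open U" for U :: "circle set"
  proof -
    have "to_circle -` ((\<lambda>x. g + x) -` U) = (\<lambda>x. r + x) -` (to_circle -` U)"
      by (auto simp: to_circle_add r)
    moreover have "open \<dots>"
      using that by (intro open_vimage continuous_intros continuous_to_circle)
    ultimately show ?thesis by (simp add: open_circle_def)
  qed
  then show ?thesis by (auto simp: continuous_on_open_vimage)
qed

lemma normalized_haar_exists: "\<exists>\<mu> :: (circle^'n^'m) measure. normalized_haar \<mu>"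
proof -
  define p :: "real^'n^'m \<Rightarrow> circle^'n^'m" where "p x = (\<chi> i j. to_circle (x $ i $ j))" for x
  define Q where "Q = {x :: real^'n^'m. \<forall>b\<in>Basis. 0 \<le> x \<bullet> b \<and> x \<bullet> b < 1}"
  define \<mu> where "\<mu> = distr (restrict_space lborel Q) borel p"
  have Qb: "Q \<in> sets borel"
    unfolding Q_def by measurable
  have p_add: "p (x + y) = p x + p y" for x y
    by (simp add: p_def vec_eq_iff to_circle_add)
  have p_surj: "\<exists>x. p x = G" for G
  proof -
    obtain f where f: "\<And>i j. to_circle (f i j) = G $ i $ j"
    proof
      show "to_circle ((SOME x. to_circle x = G $ i $ j)) = G $ i $ j" for i j
        by (rule someI_ex) (rule to_circle_surj)
    qed
    then have "p (\<chi> i j. f i j) = G" by (simp add: p_def vec_eq_iff)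
    then show ?thesis ..
  qed
  have p_cont: "continuous_on UNIV p"
    unfolding p_def
    by (intro continuous_on_vec_lambda continuous_on_compose2[OF continuous_to_circle] continuous_intros) auto
  then have p_meas[measurable]: "p \<in> borel_measurable borel"
    by (rule borel_measurable_continuous_onI)
  have em: "emeasure \<mu> B = emeasure lborel (p -` B \<inter> Q)" if "B \<in> sets borel" for B
  proof -
    have "emeasure \<mu> B = emeasure (restrict_space lborel Q) (p -` B \<inter> Q)"
      unfolding \<mu>_def using that
      by (subst emeasure_distr) (auto simp: space_restrict_space intro: measurable_restrict_space1)
    also have "\<dots> = emeasure lborel (p -` B \<inter> Q)"
      using Qb by (intro emeasure_restrict_space) auto
    finally show ?thesis .
  qed
  have "emeasure lborel Q = 1"
  proof (rule antisym)
    have "emeasure lborel Q \<le> emeasure lborel (cbox 0 (One :: real^'n^'m))"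
      using Qb by (intro emeasure_mono) (auto simp: Q_def mem_box less_imp_le)
    then show "emeasure lborel Q \<le> 1" by (simp add: emeasure_lborel_cbox_eq)
    have "emeasure lborel (box 0 (One :: real^'n^'m)) \<le> emeasure lborel Q"
      using Qb by (intro emeasure_mono) (auto simp: Q_def mem_box less_imp_le)
    then show "1 \<le> emeasure lborel Q" by (simp add: emeasure_lborel_box_eq)
  qed
  then have tot: "emeasure \<mu> UNIV = 1" by (simp add: em)
  have inv: "emeasure \<mu> ((\<lambda>A. G + A) ` B) = emeasure \<mu> B" if B: "B \<in> sets borel" for G B
  proof -
    obtain t where t: "p t = - G" using p_surj by blast
    have img: "(\<lambda>A. G + A) ` B = (\<lambda>A. - G + A) -` B"
      by (auto simp: image_iff) (metis add.commute add_diff_cancel_right' diff_add_cancel)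
    have vecadd: "(\<lambda>A. - G + A) = (\<lambda>A. \<chi> i j. (- G) $ i $ j + A $ i $ j)"
      by (auto simp: fun_eq_iff vec_eq_iff)
    have "continuous_on UNIV (\<lambda>A. - G + A)"
      unfolding vecadd
      by (intro continuous_on_vec_lambda continuous_on_compose2[OF continuous_circle_add] continuous_intros) auto
    then have "(\<lambda>A. - G + A) \<in> borel_measurable borel"
      by (rule borel_measurable_continuous_onI)
    from measurable_sets[OF this B] have mi: "(\<lambda>A. - G + A) -` B \<in> sets borel" by simp
    have "emeasure \<mu> ((\<lambda>A. G + A) ` B) = emeasure lborel (p -` ((\<lambda>A. - G + A) -` B) \<inter> Q)"
      unfolding img by (rule em[OF mi])
    also have "p -` ((\<lambda>A. - G + A) -` B) = (\<lambda>x. x + t) -` (p -` B)"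
      by (auto simp: p_add t add.commute)
    also have "emeasure lborel ((\<lambda>x. x + t) -` (p -` B) \<inter> Q) = emeasure lborel (p -` B \<inter> Q)"
      unfolding Q_def
    proof (rule lborel_periodic)
      show "p -` B \<in> sets borel" using measurable_sets[OF p_meas B] by simp
      fix x k :: "real^'n^'m"
      assume k: "\<forall>b\<in>Basis. k \<bullet> b \<in> \<int>"
      have "k $ i $ j \<in> \<int>" for i j
      proof -
        have "axis i (axis j 1) \<in> (Basis :: (real^'n^'m) set)"
          by (simp add: axis_in_Basis_iff)
        with k have "k \<bullet> axis i (axis j 1) \<in> \<int>" by blast
        then show ?thesis by (simp add: inner_axis)
      qed
      then have "p (x + k) = p x" by (simp add: p_def vec_eq_iff to_circle_eq_iff)
      then show "x + k \<in> p -` B \<longleftrightarrow> x \<in> p -` B" by simp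
    qed
    also have "\<dots> = emeasure \<mu> B" by (simp add: em[OF B])
    finally show ?thesis .
  qed
  have "normalized_haar \<mu>"
    unfolding normalized_haar_def using tot inv by (auto simp: \<mu>_def)
  then show ?thesis ..
qed

end

theory Submission
  imports Defs
begin

text \<open>For \<open>\<xi> \<noteq> 0\<close> the point \<open>A \<xi>\<close> is uniformly distributed on the torus, so the expectation of
  \<open>min (F (A \<xi>)) T\<close> is the truncated exponential series of \<open>ln T\<close> if \<open>T \<ge> 1\<close>. The sum of the \<open>F (A \<xi>)\<close>
  exceeds \<open>B\<close> only if the sum of the \<open>min (F (A \<xi>)) B\<close> is at least \<open>B\<close>, and Markov's inequality
  with \<open>B\<close> equal to the claimed bound gives the result.\<close>

section \<open>The truncated exponential series\<close>

text \<open>The Taylor polynomial of degree \<open>k\<close> of the exponential; the sum in the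
  theorem is its value at the logarithm of |X| / \<epsilon>.\<close>

definition exp_trunc :: "nat \<Rightarrow> real \<Rightarrow> real" where
  "exp_trunc k x = (\<Sum>m=0..k. x ^ m / fact m)"

lemma exp_trunc_0 [simp]: "exp_trunc 0 x = 1"
  by (simp add: exp_trunc_def)

lemma exp_trunc_Suc: "exp_trunc (Suc k) x = exp_trunc k x + x ^ Suc k / fact (Suc k)"
  by (simp add: exp_trunc_def)

lemma exp_trunc_zero [simp]: "exp_trunc k 0 = 1"
  by (induction k) (simp_all add: exp_trunc_Suc)

text \<open>Differentiation lowers the degree by one. This drives both the monotonicity behind
  \<open>exp_trunc_add_le\<close> and the antiderivative in
  \<open>nn_integral_trunc_moment\<close>.\<close>

lemma DERIV_exp_trunc_Suc: "(exp_trunc (Suc k) has_real_derivative exp_trunc k x) (at x)"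
proof (induction k)
  case 0
  have "exp_trunc (Suc 0) = (\<lambda>x. 1 + x)"
    by (simp add: exp_trunc_Suc fun_eq_iff)
  then show ?case by (auto intro!: derivative_eq_intros)
next
  case (Suc k)
  have eq: "exp_trunc (Suc (Suc k)) =
      (\<lambda>x. exp_trunc (Suc k) x + x ^ Suc (Suc k) / fact (Suc (Suc k)))"
    by (simp add: exp_trunc_Suc fun_eq_iff)
  have "((\<lambda>x::real. x ^ Suc (Suc k) / fact (Suc (Suc k))) has_real_derivative
      x ^ Suc k / fact (Suc k)) (at x)"
  proof -
    have "((\<lambda>x::real. x ^ Suc (Suc k)) has_real_derivative of_nat (Suc (Suc k)) * x ^ Suc k) (at x)"
      using DERIV_pow[of "Suc (Suc k)" x UNIV] by simp
    from DERIV_cdivide[OF this, of "fact (Suc (Suc k))"]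
    have "((\<lambda>x::real. x ^ Suc (Suc k) / fact (Suc (Suc k))) has_real_derivative
      of_nat (Suc (Suc k)) * x ^ Suc k / fact (Suc (Suc k))) (at x)" .
    also have "of_nat (Suc (Suc k)) * x ^ Suc k / fact (Suc (Suc k)) = x ^ Suc k / fact (Suc k)"
      unfolding fact_Suc[of "Suc k"] of_nat_mult by (simp del: of_nat_Suc fact_Suc power_Suc)
    finally show ?thesis .
  qed
  from DERIV_add[OF Suc.IH this] show ?case
    unfolding eq by (simp only: exp_trunc_Suc[of k x])
qed

lemma exp_trunc_ge_1: "0 \<le> x \<Longrightarrow> 1 \<le> exp_trunc k x"
  by (induction k) (simp_all add: exp_trunc_Suc add_increasing2)

lemma exp_trunc_mono:
  assumes "0 \<le> x" "x \<le> y" shows "exp_trunc k x \<le> exp_trunc k y"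
  unfolding exp_trunc_def
  using assms by (intro sum_mono divide_right_mono power_mono) auto

text \<open>A partial sum of a series with nonnegative terms. It gives
  \<open>ln (exp_trunc k l) \<le> l\<close>, so the polynomial factor of \<open>B\<close> adds at
  most another \<open>ln Y\<close> to \<open>ln B\<close>.\<close>

lemma exp_trunc_le_exp:
  assumes "0 \<le> x" shows "exp_trunc k x \<le> exp x"
proof -
  have s: "(\<lambda>m. x ^ m / fact m) sums exp x"
    using exp_converges[of x] by (simp add: scaleR_conv_of_real divide_inverse mult.commute)
  have "(\<Sum>m\<in>{0..k}. x ^ m / fact m) \<le> (\<Sum>m. x ^ m / fact m)"
    using assms by (intro sum_le_suminf sums_summable[OF s]) auto
  then show ?thesis using sums_unique[OF s] by (simp add: exp_trunc_def)
qed

text \<open>Doubling the argument multiplies the term of degree \<open>m\<close> by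
  \<open>2 ^ m\<close>, and \<open>m\<close> is at most \<open>k\<close>.\<close>

lemma exp_trunc_double:
  assumes "0 \<le> x" shows "exp_trunc k (2 * x) \<le> 2 ^ k * exp_trunc k x"
  unfolding exp_trunc_def sum_distrib_left
proof (rule sum_mono)
  fix m assume "m \<in> {0..k}"
  then have "(2::real) ^ m \<le> 2 ^ k" by (intro power_increasing) auto
  then have "2 ^ m * (x ^ m / fact m) \<le> 2 ^ k * (x ^ m / fact m)"
    using assms by (intro mult_right_mono) auto
  then show "(2 * x) ^ m / fact m \<le> 2 ^ k * (x ^ m / fact m)"
    by (simp add: power_mult_distrib)
qed

text \<open>The function \<open>x \<mapsto> exp (- x) * exp_trunc k x\<close> is decreasing on the nonnegative reals.\<close>

lemma exp_trunc_add_le: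
  assumes "0 \<le> a" "0 \<le> b" shows "exp_trunc k (a + b) \<le> exp b * exp_trunc k a"
proof (cases k)
  case 0
  with assms show ?thesis by simp
next
  case (Suc j)
  have "exp (- (a + b)) * exp_trunc k (a + b) \<le> exp (- a) * exp_trunc k a"
  proof (rule DERIV_nonpos_imp_nonincreasing[of a "a + b" "\<lambda>x. exp (- x) * exp_trunc k x"])
    fix x assume x: "a \<le> x" "x \<le> a + b"
    \<comment> \<open>The two polynomials differ only in the top term, so the derivative is minus
      \<open>exp (- x)\<close> times that term.\<close>
    have "((\<lambda>x. exp (- x) * exp_trunc k x) has_real_derivative
        exp (- x) * exp_trunc j x - exp (- x) * exp_trunc k x) (at x)"
      unfolding Suc by (auto intro!: derivative_eq_intros DERIV_exp_trunc_Suc)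
    moreover have "exp_trunc j x \<le> exp_trunc k x"
      using x assms unfolding Suc exp_trunc_Suc by (simp add: add_increasing2)
    ultimately show "\<exists>y. ((\<lambda>x. exp (- x) * exp_trunc k x) has_real_derivative y) (at x) \<and> y \<le> 0"
      by (intro exI conjI) auto
  qed (use assms in auto)
  then have "exp (a + b) * (exp (- (a + b)) * exp_trunc k (a + b))
      \<le> exp (a + b) * (exp (- a) * exp_trunc k a)"
    by (intro mult_left_mono) auto
  also have "exp (a + b) * (exp (- a) * exp_trunc k a) = exp b * exp_trunc k a"
    by (simp add: mult.assoc[symmetric] flip: exp_add)
  also have "exp (a + b) * (exp (- (a + b)) * exp_trunc k (a + b)) = exp_trunc k (a + b)"
    by (simp add: mult.assoc[symmetric] flip: exp_add)
  finally show ?thesis .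
qed

text \<open>With \<open>B = 8 ^ k * Y * exp_trunc k (ln Y)\<close> one has \<open>ln B \<le> 2 * ln Y + k * ln 8\<close>, and
  \<open>2 * exp (ln 8 / 2) \<le> 8\<close>.\<close>

lemma exp_trunc_ln_le:
  fixes Y :: real
  assumes "1 \<le> Y"
  shows "exp_trunc k (ln (8 ^ k * Y * exp_trunc k (ln Y))) \<le> 8 ^ k * exp_trunc k (ln Y)"
proof -
  define l where "l = ln Y"
  have l: "0 \<le> l" "exp l = Y" using assms by (auto simp: l_def)
  have g1: "1 \<le> exp_trunc k l" using l(1) by (rule exp_trunc_ge_1)
  have "ln (8 ^ k * Y * exp_trunc k l) = real k * ln 8 + l + ln (exp_trunc k l)"
    using assms g1 by (simp add: ln_mult ln_realpow l_def)
  also have "\<dots> \<le> real k * ln 8 + l + l"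
    using exp_trunc_le_exp[OF l(1), of k] g1 by (simp add: ln_le_cancel_iff[symmetric])
  finally have le: "ln (8 ^ k * Y * exp_trunc k l) \<le> 2 * (l + real k * ln 8 / 2)" by simp
  have "1 * 1 * 1 \<le> 8 ^ k * Y * exp_trunc k l"
    using assms g1 by (intro mult_mono) auto
  then have "0 \<le> ln (8 ^ k * Y * exp_trunc k l)" by simp
  from exp_trunc_mono[OF this le]
  have "exp_trunc k (ln (8 ^ k * Y * exp_trunc k l)) \<le> exp_trunc k (2 * (l + real k * ln 8 / 2))" .
  also have "\<dots> \<le> 2 ^ k * exp_trunc k (l + real k * ln 8 / 2)"
    using l by (intro exp_trunc_double) auto
  also have "\<dots> \<le> 2 ^ k * (exp (real k * ln 8 / 2) * exp_trunc k l)"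
    using l by (intro mult_left_mono exp_trunc_add_le) auto
  also have "\<dots> \<le> 2 ^ k * (4 ^ k * exp_trunc k l)"
  proof -
    \<comment> \<open>The factor \<open>exp (ln 8 / 2)\<close> is the square root of 8; bounding it
      by 4 makes the final base 2 * 4 = 8.\<close>
    have "ln 8 \<le> ln (4 * 4 :: real)" by (subst ln_le_cancel_iff) auto
    also have "\<dots> = ln 4 + ln 4" by (rule ln_mult_pos) auto
    finally have "ln 8 / 2 \<le> ln (4 :: real)" by simp
    then have "real k * (ln 8 / 2) \<le> real k * ln 4" by (intro mult_left_mono) auto
    then have "exp (real k * ln 8 / 2) \<le> exp (real k * ln 4)" by simp
    also have "exp (real k * ln 4) = (4::real) ^ k" by (simp add: exp_of_nat_mult)
    finally show ?thesis using g1 by (intro mult_left_mono mult_right_mono) auto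
  qed
  also have "\<dots> = 8 ^ k * exp_trunc k l"
    by (simp add: mult.assoc[symmetric] flip: power_mult_distrib)
  finally show ?thesis by (simp add: l_def)
qed

section \<open>The truncated moment of a product of uniform variables\<close>

text \<open>The expectation of \<open>min (1 / (u\<^sub>1 \<cdots> u\<^sub>k)) T\<close> for independent \<open>u\<^sub>i\<close> uniform on
  the unit interval.\<close>

definition trunc_moment :: "nat \<Rightarrow> real \<Rightarrow> real" where
  "trunc_moment k T = (if T \<le> 1 then T else exp_trunc k (ln T))"

lemma trunc_moment_nonneg: "0 \<le> T \<Longrightarrow> 0 \<le> trunc_moment k T"
  using exp_trunc_ge_1[of "ln T" k] by (auto simp: trunc_moment_def)

lemma exp_trunc_measurable [measurable]: "exp_trunc k \<in> borel_measurable borel"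
  unfolding exp_trunc_def by measurable

lemma trunc_moment_measurable [measurable]: "trunc_moment k \<in> borel_measurable borel"
  unfolding trunc_moment_def by measurable

text \<open>Recursion on the number of variables: if the last one equals \<open>u\<close>, then
  \<open>min (P / u) T = min P (u * T) / u\<close>, and averaging over \<open>u\<close> brings in
  one more variable.\<close>

lemma nn_integral_trunc_moment:
  assumes "0 \<le> T"
  shows "(\<integral>\<^sup>+u\<in>{0<..<1}. ennreal (trunc_moment k (u * T) / u) \<partial>lborel) =
    ennreal (trunc_moment (Suc k) T)"
proof (cases "T \<le> 1")
  case True
  \<comment> \<open>Then \<open>u * T\<close> stays in the linear branch, where the integrand is the
    constant \<open>T\<close>.\<close>
  have "u * T \<le> 1" if "0 < u" "u < 1" for u :: real
    using mult_mono[of u 1 T 1] that True assms by simp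
  then have "(\<integral>\<^sup>+u\<in>{0<..<1}. ennreal (trunc_moment k (u * T) / u) \<partial>lborel)
      = (\<integral>\<^sup>+u\<in>{0<..<1}. ennreal T \<partial>(lborel :: real measure))"
    by (intro nn_integral_cong) (auto simp: trunc_moment_def indicator_def)
  also have "\<dots> = ennreal T" by (simp add: nn_integral_cmult_indicator)
  finally show ?thesis using True by (simp add: trunc_moment_def)
next
  case False
  define f where "f u = exp_trunc k (ln (u * T)) / u" for u
  have T: "1 < T" "0 < T" using False by auto
  then have iT: "0 < 1/T" "1/T < 1" by auto
  \<comment> \<open>The branch changes at \<open>u = 1/T\<close>. The part below contributes
    \<open>T * (1/T) = 1\<close>, the part above is integrated by an antiderivative.\<close>
  have split: "ennreal (trunc_moment k (u * T) / u) * indicator {0<..<1} u =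
      ennreal T * indicator {0<..1/T} u + ennreal (f u) * indicator {1/T<..<1} u" for u
  proof -
    have "u * T \<le> 1 \<longleftrightarrow> u \<le> 1/T" using T by (simp add: field_simps)
    moreover have "u < 1" if "u \<le> 1/T" using that iT(2) by (rule le_less_trans)
    moreover have "0 < u" if "1/T < u" using that iT by linarith
    ultimately show ?thesis
      by (auto simp: trunc_moment_def f_def indicator_def not_le)
  qed
  have mf [measurable]: "f \<in> borel_measurable borel" unfolding f_def by measurable
  have A: "(\<integral>\<^sup>+u. ennreal T * indicator {0<..1/T} u \<partial>lborel) = 1"
    using T ennreal_mult[of T "1/T"] by (simp add: nn_integral_cmult_indicator)
  \<comment> \<open>The two endpoints are null; the fundamental theorem is applied on the closed
    interval.\<close>
  have "(\<integral>\<^sup>+u. ennreal (f u) * indicator {1/T<..<1} u \<partial>lborel)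
      = (\<integral>\<^sup>+u. ennreal (f u) * indicator {1/T..1} u \<partial>lborel)"
    using AE_lborel_singleton[of "1::real"] AE_lborel_singleton[of "1/T"]
    by (intro nn_integral_cong_AE) (elim AE_mp, auto simp: indicator_def)
  \<comment> \<open>Since \<open>ln (u * T)\<close> has derivative \<open>1 / u\<close>, the chain
    rule yields the antiderivative. Its value at \<open>1/T\<close> is 1, which cancels against the
    contribution of the part below.\<close>
  also have "\<dots> = ennreal (exp_trunc (Suc k) (ln (1 * T)) - exp_trunc (Suc k) (ln (1/T * T)))"
  proof (rule nn_integral_FTC_Icc[where F = "\<lambda>u. exp_trunc (Suc k) (ln (u * T))"])
    fix u assume u: "u \<in> {1/T..1}"
    then have "1/T \<le> u" by simp
    with iT(1) have "0 < u" by (rule less_le_trans)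
    then have "((\<lambda>u. ln (u * T)) has_real_derivative 1 / u) (at u)"
      using T by (auto intro!: derivative_eq_intros)
    from DERIV_chain2[OF DERIV_exp_trunc_Suc this]
    show "((\<lambda>u. exp_trunc (Suc k) (ln (u * T))) has_real_derivative f u) (at u)"
      by (simp add: f_def)
    have "1 \<le> u * T" using u T by (simp add: field_simps)
    then show "0 \<le> f u"
      unfolding f_def using \<open>0 < u\<close> exp_trunc_ge_1[of "ln (u * T)" k]
      by auto
  qed (use iT in auto)
  also have "\<dots> = ennreal (exp_trunc (Suc k) (ln T) - 1)"
    using T by simp
  finally have B: "(\<integral>\<^sup>+u. ennreal (f u) * indicator {1/T<..<1} u \<partial>lborel)
      = ennreal (exp_trunc (Suc k) (ln T) - 1)" .
  have "(\<integral>\<^sup>+u\<in>{0<..<1}. ennreal (trunc_moment k (u * T) / u) \<partial>lborel)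
      = 1 + ennreal (exp_trunc (Suc k) (ln T) - 1)"
    unfolding split by (subst nn_integral_add) (simp_all add: A B)
  also have "\<dots> = ennreal (exp_trunc (Suc k) (ln T))"
    using exp_trunc_ge_1[of "ln T" "Suc k"] T by (simp flip: ennreal_1 ennreal_plus)
  finally show ?thesis using False by (simp add: trunc_moment_def)
qed


section \<open>Real representatives of circle elements and of the coordinates of A \<xi>\<close>

text \<open>A section of \<open>to_circle\<close> through which measurability questions on the
  circle are moved to the reals.\<close>

lift_definition circle_frac :: "circle \<Rightarrow> real" is "frac :: real \<Rightarrow> real"
proof -
  fix x y :: real
  assume "x - y \<in> \<int>"
  then obtain k where "x - y = of_int k" by (rule Ints_cases)
  then have "x = y + of_int k" by simp
  then show "frac x = frac y" by (simp add: frac_def)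
qed

lemma to_circle_circle_frac [simp]: "to_circle (circle_frac a) = a"
  by transfer (simp add: frac_def)

lemma circle_frac_to_circle [simp]: "circle_frac (to_circle x) = frac x"
  by transfer simp

lemma circle_norm_to_circle: "circle_norm (to_circle x) = infdist x \<int>"
  by transfer simp

text \<open>The function jumps at 0 but is lower semicontinuous: for \<open>c \<ge> 0\<close> the
  set where it exceeds \<open>c\<close> pulls back to the union of the open intervals from
  \<open>c + k\<close> to \<open>1 + k\<close>.\<close>

lemma circle_frac_measurable: "circle_frac \<in> borel_measurable borel"
proof (rule borel_measurableI_greater)
  fix c :: real
  have "open {a. c < circle_frac a}"
  proof (cases "c < 0")
    case True
    have "0 \<le> circle_frac a" for a by transfer simp
    with True have "{a. c < circle_frac a} = UNIV" by (auto intro: less_le_trans)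
    then show ?thesis by simp
  next
    case False
    have "c < frac x \<longleftrightarrow> (\<exists>k::int. c + of_int k < x \<and> x < 1 + of_int k)" for x
    proof
      assume "c < frac x"
      then show "\<exists>k::int. c + of_int k < x \<and> x < 1 + of_int k"
        using frac_lt_1[of x] by (intro exI[of _ "\<lfloor>x\<rfloor>"]) (simp add: frac_def)
    next
      assume "\<exists>k::int. c + of_int k < x \<and> x < 1 + of_int k"
      then obtain k :: int where k: "c + of_int k < x" "x < 1 + of_int k" by blast
      then have "\<lfloor>x\<rfloor> = k" using False by (intro floor_unique) auto
      then show "c < frac x" using k by (simp add: frac_def)
    qed
    then have "to_circle -` {a. c < circle_frac a} = (\<Union>k::int. {c + of_int k <..< 1 + of_int k})"
      by auto
    then show ?thesis by (simp add: open_circle_def open_UN)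
  qed
  then show "{a \<in> space borel. c < circle_frac a} \<in> sets borel" by simp
qed

lemma circle_scale_to_circle: "circle_scale k (to_circle x) = to_circle (of_int k * x)"
  by transfer simp

lemma circle_scale_add: "circle_scale k (a + b) = circle_scale k a + circle_scale k b"
  by transfer (simp add: algebra_simps)

lemma circle_scale_zero [simp]: "circle_scale k 0 = 0"
  by transfer simp

lemma to_circle_zero: "to_circle 0 = 0"
  by transfer simp

lemma to_circle_sum: "to_circle (\<Sum>i\<in>I. f i) = (\<Sum>i\<in>I. to_circle (f i))"
  by (induction I rule: infinite_finite_induct)
    (simp_all add: to_circle_add to_circle_zero)

text \<open>Lifts a coordinate to a real linear form in the representatives, which is measurable and
  can be shifted by a real number.\<close>

lemma mat_apply_nth:
  "mat_apply A \<xi> $ m = to_circle (\<Sum>n\<in>UNIV. of_int (\<xi> $ n) * circle_frac (A $ m $ n))"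
proof -
  have "circle_scale k a = to_circle (of_int k * circle_frac a)" for k a
    using circle_scale_to_circle[of k "circle_frac a"] by simp
  then show ?thesis by (simp add: mat_apply_def to_circle_sum)
qed

lemma mat_apply_add: "mat_apply (A + B) \<xi> = mat_apply A \<xi> + mat_apply B \<xi>"
  by (simp add: mat_apply_def vec_eq_iff circle_scale_add sum.distrib)

section \<open>The distance of a uniform point to the nearest integer\<close>

lemma infdist_Ints:
  assumes "0 \<le> y" "y \<le> 1" shows "infdist y \<int> = min y (1 - y)"
proof (rule antisym)
  show "infdist y \<int> \<le> min y (1 - y)"
    using assms infdist_le[of 0 "\<int>" y] infdist_le[of 1 "\<int>" y] by (simp add: dist_real_def)
  have ne: "(\<int> :: real set) \<noteq> {}" using Ints_0 by blast
  show "min y (1 - y) \<le> infdist y \<int>"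
    unfolding infdist_notempty[OF ne]
  proof (rule cINF_greatest[OF ne])
    fix k :: real assume "k \<in> \<int>"
    then obtain i where i: "k = of_int i" by (rule Ints_cases)
    consider "i \<le> 0" | "1 \<le> i" by linarith
    then show "min y (1 - y) \<le> dist y k"
    proof cases
      case 1
      then have "real_of_int i \<le> 0" by simp
      then show ?thesis using assms by (simp add: dist_real_def i)
    next
      case 2
      then have "1 \<le> real_of_int i" by simp
      then show ?thesis using assms by (simp add: dist_real_def i)
    qed
  qed
qed

lemma infdist_Ints_measurable [measurable]: "(\<lambda>x :: real. infdist x \<int>) \<in> borel_measurable borel"
  by (intro borel_measurable_continuous_onI continuous_intros)

text \<open>Periodicity removes the shift \<open>v\<close>; the tent map then carries each half of
  the unit interval affinely onto the whole, with density 1/2.\<close>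

lemma nn_integral_infdist_Ints:
  fixes h :: "real \<Rightarrow> ennreal"
  assumes [measurable]: "h \<in> borel_measurable borel"
  shows "(\<integral>\<^sup>+y\<in>{0..<1::real}. h (2 * infdist (v + y) \<int>) \<partial>lborel) = (\<integral>\<^sup>+u\<in>{0<..<1}. h u \<partial>lborel)"
proof -
  define D where "D = (\<lambda>y :: real. 2 * infdist y \<int>)"
  have [measurable]: "D \<in> borel_measurable borel" unfolding D_def by measurable
  define R where "R = restrict_space lborel {0..<1::real}"
  have mR: "f \<in> borel_measurable R" if "f \<in> borel_measurable borel" for f :: "real \<Rightarrow> real"
    unfolding R_def using that by (auto intro: measurable_restrict_space1)
  have [measurable]: "(\<lambda>y. D (v + y)) \<in> borel_measurable borel" by measurable
  have "distr R borel (\<lambda>y. D (v + y)) = distr R borel D"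
  proof (rule measure_eqI)
    fix B assume "B \<in> sets (distr R borel (\<lambda>y. D (v + y)))"
    then have B [measurable]: "B \<in> sets borel" by simp
    have "emeasure (distr R borel (\<lambda>y. D (v + y))) B = emeasure R ((\<lambda>y. D (v + y)) -` B \<inter> space R)"
      by (intro emeasure_distr mR B) measurable
    \<comment> \<open>On the reals \<open>Basis\<close> is \<open>{1}\<close>, so the second set is
      \<open>{0..<1}\<close> in the form that \<open>lborel_periodic\<close> uses.\<close>
    also have "\<dots> = emeasure lborel ((\<lambda>x. x + v) -` (D -` B) \<inter> {x. \<forall>b\<in>Basis. 0 \<le> x \<bullet> b \<and> x \<bullet> b < 1})"
      unfolding R_def
      by (subst emeasure_restrict_space)
        (auto simp: space_restrict_space add.commute intro!: arg_cong[of _ _ "emeasure lborel"])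
    also have "\<dots> = emeasure lborel (D -` B \<inter> {x. \<forall>b\<in>Basis. 0 \<le> x \<bullet> b \<and> x \<bullet> b < 1})"
    proof (rule lborel_periodic)
      show "D -` B \<in> sets borel" using measurable_sets[of D borel borel B] by simp
      fix x k :: real assume "\<forall>b\<in>Basis. k \<bullet> b \<in> \<int>"
      \<comment> \<open>\<open>D\<close> factors through the circle as twice
        \<open>circle_norm\<close>, hence is periodic.\<close>
      then have "to_circle (x + k) = to_circle x" by (simp add: to_circle_eq_iff)
      then show "x + k \<in> D -` B \<longleftrightarrow> x \<in> D -` B"
        by (simp add: D_def flip: circle_norm_to_circle)
    qed
    also have "\<dots> = emeasure R (D -` B \<inter> space R)"
      unfolding R_def
      by (subst emeasure_restrict_space)
        (auto simp: space_restrict_space intro!: arg_cong[of _ _ "emeasure lborel"])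
    also have "\<dots> = emeasure (distr R borel D) B"
      by (intro emeasure_distr[symmetric] mR B) measurable
    finally show "emeasure (distr R borel (\<lambda>y. D (v + y))) B = emeasure (distr R borel D) B" .
  qed simp
  then have "(\<integral>\<^sup>+x. h x \<partial>distr R borel (\<lambda>y. D (v + y))) = (\<integral>\<^sup>+x. h x \<partial>distr R borel D)" by simp
  moreover have "(\<integral>\<^sup>+x. h x \<partial>distr R borel (\<lambda>y. D (v + y))) = (\<integral>\<^sup>+y. h (D (v + y)) \<partial>R)"
    by (intro nn_integral_distr mR) measurable
  moreover have "(\<integral>\<^sup>+x. h x \<partial>distr R borel D) = (\<integral>\<^sup>+y. h (D y) \<partial>R)"
    by (intro nn_integral_distr mR) measurable
  ultimately have "(\<integral>\<^sup>+y\<in>{0..<1}. h (D (v + y)) \<partial>lborel) = (\<integral>\<^sup>+y\<in>{0..<1}. h (D y) \<partial>lborel)"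
    unfolding R_def by (simp add: nn_integral_restrict_space)
  \<comment> \<open>The two slopes of the tent; the points 0 and 1/2 are null.\<close>
  also have "\<dots> = (\<integral>\<^sup>+y. h (2 * y) * indicator {0<..<1/2} y + h (2 - 2 * y) * indicator {1/2<..<1} y \<partial>lborel)"
    using AE_lborel_singleton[of "0::real"] AE_lborel_singleton[of "1/2::real"]
    by (intro nn_integral_cong_AE)
      (elim AE_mp, auto simp: indicator_def D_def infdist_Ints min_def algebra_simps)
  also have "\<dots> = (\<integral>\<^sup>+y. h (2 * y) * indicator {0<..<1/2} y \<partial>lborel)
      + (\<integral>\<^sup>+y. h (2 - 2 * y) * indicator {1/2<..<1} y \<partial>lborel)"
    by (intro nn_integral_add) measurable
  \<comment> \<open>The substitutions \<open>y = u / 2\<close> here and \<open>y = 1 - u / 2\<close>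
    below each give half of the integral.\<close>
  also have "(\<integral>\<^sup>+y. h (2 * y) * indicator {0<..<1/2} y \<partial>lborel)
      = ennreal (1/2) * (\<integral>\<^sup>+u\<in>{0<..<1}. h u \<partial>lborel)"
    by (subst nn_integral_real_affine[where c = "1/2" and t = 0]) 
      (auto simp: indicator_def intro!: arg_cong2[of _ _ _ _ "(*)"] nn_integral_cong)
  also have "(\<integral>\<^sup>+y. h (2 - 2 * y) * indicator {1/2<..<1} y \<partial>lborel)
      = ennreal (1/2) * (\<integral>\<^sup>+u\<in>{0<..<1}. h u \<partial>lborel)"
    by (subst nn_integral_real_affine[where c = "-1/2" and t = 1])
      (auto simp: indicator_def intro!: arg_cong2[of _ _ _ _ "(*)"] nn_integral_cong)
  also have "ennreal (1/2) * (\<integral>\<^sup>+u\<in>{0<..<1}. h u \<partial>lborel) + ennreal (1/2) * (\<integral>\<^sup>+u\<in>{0<..<1}. h u \<partial>lborel)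
      = (\<integral>\<^sup>+u\<in>{0<..<1}. h u \<partial>lborel)"
  proof -
    have "ennreal (1/2) + ennreal (1/2) = 1" by (subst ennreal_plus[symmetric]) auto
    then show ?thesis by (simp only: distrib_right[symmetric] mult_1_left)
  qed
  finally show ?thesis unfolding D_def .
qed

text \<open>Multiplication by \<open>1/u\<close> is monotone and so commutes with
  \<open>min\<close>, even for infinite \<open>P\<close>. The level \<open>T\<close> becomes
  \<open>u * T\<close>, as in the recursion for \<open>trunc_moment\<close>.\<close>

lemma min_mult_inverse_ennreal:
  assumes "0 < u" "0 \<le> T"
  shows "min (P * inverse (ennreal u)) (ennreal T) = min P (ennreal (u * T)) * inverse (ennreal u)"
proof -
  have "inverse (ennreal u) = ennreal (1/u)" using assms by (simp add: inverse_ennreal inverse_eq_divide)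
  moreover have "ennreal T = ennreal (u * T) * ennreal (1/u)"
    using assms by (simp flip: ennreal_mult)
  ultimately show ?thesis
    using min_of_mono[of "\<lambda>x. x * ennreal (1/u)" P "ennreal (u * T)"]
    by (simp add: mono_def mult_right_mono)
qed

section \<open>Haar invariance, measurability and translation of a single row\<close>

lemma continuous_matrix_add: "continuous_on UNIV (\<lambda>A :: circle^'n^'m. G + A)"
proof -
  have "(\<lambda>A. G + A) = (\<lambda>A. \<chi> i j. G $ i $ j + A $ i $ j)"
    by (auto simp: fun_eq_iff vec_eq_iff)
  then show ?thesis
    by (simp only:)
      (intro continuous_on_vec_lambda continuous_on_compose2[OF continuous_circle_add]
        continuous_intros; auto)
qed

text \<open>Invariance, given for images of sets, passes to integrals through \<open>distr\<close>:
  a preimage under translation by \<open>G\<close> is an image under translation by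
  \<open>- G\<close>.\<close>

lemma nn_integral_haar_translate:
  fixes \<mu> :: "(circle^'n^'m) measure"
  assumes haar: "normalized_haar \<mu>" and f: "f \<in> borel_measurable \<mu>"
  shows "(\<integral>\<^sup>+A. f (G + A) \<partial>\<mu>) = (\<integral>\<^sup>+A. f A \<partial>\<mu>)"
proof -
  have sets: "sets \<mu> = sets borel" using haar by (simp add: normalized_haar_def)
  have add: "(\<lambda>A. G + A) \<in> measurable \<mu> \<mu>"
    unfolding measurable_cong_sets[OF sets sets]
    by (intro borel_measurable_continuous_onI continuous_matrix_add)
  have "distr \<mu> \<mu> (\<lambda>A. G + A) = \<mu>"
  proof (rule measure_eqI)
    fix B assume "B \<in> sets (distr \<mu> \<mu> (\<lambda>A. G + A))"
    then have B: "B \<in> sets \<mu>" by simp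
    have "(\<lambda>A. G + A) -` B = (\<lambda>A. - G + A) ` B"
      by (auto simp: image_iff) (metis add_diff_cancel_left')
    moreover have "emeasure \<mu> ((\<lambda>A. - G + A) ` B) = emeasure \<mu> B"
      using haar B unfolding normalized_haar_def sets by blast
    ultimately show "emeasure (distr \<mu> \<mu> (\<lambda>A. G + A)) B = emeasure \<mu> B"
      using sets_eq_imp_space_eq[OF sets] by (simp only: emeasure_distr[OF add B]) simp
  qed simp
  then show ?thesis using nn_integral_distr[OF add, of f] f by simp
qed

lemma row_measurable:
  fixes \<mu> :: "(circle^'n^'m) measure" and \<xi> :: "int^'n"
  assumes "sets \<mu> = sets borel"
  shows "(\<lambda>A. \<Sum>n\<in>UNIV. of_int (\<xi> $ n) * circle_frac (A $ m $ n)) \<in> borel_measurable \<mu>"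
proof -
  have "(\<lambda>A :: circle^'n^'m. A $ m $ n) \<in> borel_measurable borel" for n
    by (intro borel_measurable_continuous_onI continuous_intros)
  then have [measurable]: "(\<lambda>A :: circle^'n^'m. circle_frac (A $ m $ n)) \<in> borel_measurable borel" for n
    by (rule measurable_compose[OF _ circle_frac_measurable])
  show ?thesis
    unfolding measurable_cong_sets[OF assms refl] by measurable
qed

lemma circle_norm_mat_apply_measurable:
  fixes \<mu> :: "(circle^'n^'m) measure"
  assumes "sets \<mu> = sets borel"
  shows "(\<lambda>A. circle_norm (mat_apply A \<xi> $ m)) \<in> borel_measurable \<mu>"
  unfolding mat_apply_nth circle_norm_to_circle
  by (rule measurable_compose[OF row_measurable[OF assms] infdist_Ints_measurable])

text \<open>Here \<xi> \<noteq> 0 enters: \<open>y\<close> is divided, in the reals, by a nonzero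
  entry of \<xi>, and the quotient is placed at the single position \<open>(k, n0)\<close>.\<close>

lemma mat_apply_surj_row:
  fixes \<xi> :: "int^'n" and k :: "'m::finite"
  assumes "\<xi> \<noteq> 0"
  obtains G :: "circle^'n^'m" where "\<And>m. mat_apply G \<xi> $ m = (if m = k then to_circle y else 0)"
proof -
  obtain n0 where n0: "\<xi> $ n0 \<noteq> 0" using assms by (auto simp: vec_eq_iff)
  define G :: "circle^'n^'m" where
    "G = (\<chi> i j. if i = k \<and> j = n0 then to_circle (y / of_int (\<xi> $ n0)) else 0)"
  have "mat_apply G \<xi> $ m = (if m = k then to_circle y else 0)" for m
  proof -
    have "mat_apply G \<xi> $ m = (\<Sum>n\<in>UNIV. if n = n0 then (if m = k then to_circle y else 0) else 0)"
      unfolding mat_apply_def G_def vec_lambda_beta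
      by (intro sum.cong) (auto simp: circle_scale_to_circle n0)
    then show ?thesis by simp
  qed
  then show thesis by (rule that)
qed

section \<open>The moment bound, by induction over the rows\<close>

text \<open>Only row \<open>k\<close> is translated, by a uniformly distributed amount, which leaves the factors
  indexed by \<open>S\<close> alone; this replaces the identification of the law of \<open>mat_apply A \<xi>\<close>.\<close>

lemma nn_integral_min_prod_le:
  fixes \<mu> :: "(circle^'n^'m) measure" and S :: "'m set"
  assumes haar: "normalized_haar \<mu>" and \<xi>: "\<xi> \<noteq> 0" and "0 \<le> T"
  shows "(\<integral>\<^sup>+A. min (\<Prod>m\<in>S. inverse (ennreal (2 * circle_norm (mat_apply A \<xi> $ m)))) (ennreal T) \<partial>\<mu>)
    \<le> ennreal (trunc_moment (card S) T)"
  using finite[of S] \<open>0 \<le> T\<close>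
proof (induction S arbitrary: T rule: finite_induct)
  case empty
  \<comment> \<open>The empty product is 1 and \<open>exp_trunc 0\<close> is 1, so both sides are
    \<open>min 1 T\<close>.\<close>
  have "emeasure \<mu> (space \<mu>) = 1"
    using haar sets_eq_imp_space_eq[of \<mu> borel] by (simp add: normalized_haar_def)
  with empty show ?case
    by (auto simp: trunc_moment_def min_def)
next
  case (insert k S)
  have sets: "sets \<mu> = sets borel" and tot: "emeasure \<mu> (space \<mu>) = 1"
    using haar sets_eq_imp_space_eq[of \<mu> borel] by (auto simp: normalized_haar_def)
  interpret finite_measure \<mu> by standard (simp add: tot)
  interpret pair_sigma_finite \<mu> "lborel :: real measure" ..
  define P where "P A = (\<Prod>m\<in>S. inverse (ennreal (2 * circle_norm (mat_apply A \<xi> $ m))))" for A :: "circle^'n^'m"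
  define r where "r A = (\<Sum>n\<in>UNIV. of_int (\<xi> $ n) * circle_frac (A $ k $ n))" for A :: "circle^'n^'m"
  note circle_norm_mat_apply_measurable[OF sets, measurable]
  have [measurable]: "P \<in> borel_measurable \<mu>" unfolding P_def by measurable
  have [measurable]: "r \<in> borel_measurable \<mu>" unfolding r_def by (rule row_measurable[OF sets])
  define f where "f A = min (P A * inverse (ennreal (2 * circle_norm (mat_apply A \<xi> $ k)))) (ennreal T)" for A
  have fm: "f \<in> borel_measurable \<mu>" unfolding f_def by measurable
  define g where "g A u = min (P A * inverse (ennreal u)) (ennreal T)" for A u
  have gm [measurable]: "case_prod g \<in> borel_measurable (\<mu> \<Otimes>\<^sub>M lborel)" unfolding g_def by measurable
  have shift: "(\<integral>\<^sup>+A. f A \<partial>\<mu>) = (\<integral>\<^sup>+A. g A (2 * infdist (r A + y) \<int>) \<partial>\<mu>)" for y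
  proof -
    obtain G :: "circle^'n^'m" where G: "\<And>m. mat_apply G \<xi> $ m = (if m = k then to_circle y else 0)"
      using mat_apply_surj_row[OF \<xi>] by blast
    have "f (G + A) = g A (2 * infdist (r A + y) \<int>)" for A
    proof -
      have "P (G + A) = P A"
        unfolding P_def using insert.hyps by (intro prod.cong) (auto simp: mat_apply_add G)
      moreover have "mat_apply (G + A) \<xi> $ k = to_circle (r A + y)"
        by (simp add: mat_apply_add G mat_apply_nth[of A] r_def to_circle_add add.commute)
      ultimately show ?thesis by (simp add: f_def g_def circle_norm_to_circle)
    qed
    then show ?thesis using nn_integral_haar_translate[OF haar fm, of G] by simp
  qed
  have ind: "(\<integral>\<^sup>+y\<in>{0..<1::real}. c \<partial>lborel) = c" for c :: ennreal
    by (subst nn_integral_cmult_indicator) auto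
  \<comment> \<open>By \<open>shift\<close> the integral does not depend on \<open>y\<close>, so it
    equals its average over the unit interval.\<close>
  have "(\<integral>\<^sup>+A. f A \<partial>\<mu>) = (\<integral>\<^sup>+y\<in>{0..<1::real}. (\<integral>\<^sup>+A. f A \<partial>\<mu>) \<partial>lborel)"
    by (rule ind[symmetric])
  also have "\<dots> = (\<integral>\<^sup>+y\<in>{0..<1}. (\<integral>\<^sup>+A. g A (2 * infdist (r A + y) \<int>) \<partial>\<mu>) \<partial>lborel)"
    by (intro nn_integral_cong) (simp flip: shift)
  also have "\<dots> = (\<integral>\<^sup>+y. (\<integral>\<^sup>+A. g A (2 * infdist (r A + y) \<int>) * indicator {0..<1} y \<partial>\<mu>) \<partial>lborel)"
    by (intro nn_integral_cong nn_integral_multc[symmetric]) (simp add: g_def)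
  \<comment> \<open>With \<open>A\<close> fixed only \<open>y\<close> varies, and the next step
    replaces the norm of coordinate \<open>k\<close> by a uniform \<open>u\<close>, whatever
    \<open>r A\<close> is.\<close>
  also have "\<dots> = (\<integral>\<^sup>+A. (\<integral>\<^sup>+y. g A (2 * infdist (r A + y) \<int>) * indicator {0..<1} y \<partial>lborel) \<partial>\<mu>)"
    by (intro Fubini') (simp add: g_def)
  also have "\<dots> = (\<integral>\<^sup>+A. (\<integral>\<^sup>+u. g A u * indicator {0<..<1} u \<partial>lborel) \<partial>\<mu>)"
    by (intro nn_integral_cong nn_integral_infdist_Ints) (simp add: g_def)
  \<comment> \<open>Swapping back leaves, for fixed \<open>u\<close>, the factors in
    \<open>S\<close> truncated at \<open>u * T\<close>; the induction is over arbitrary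
    \<open>T\<close> for this reason.\<close>
  also have "\<dots> = (\<integral>\<^sup>+u. (\<integral>\<^sup>+A. g A u * indicator {0<..<1} u \<partial>\<mu>) \<partial>lborel)"
    by (intro Fubini'[symmetric]) (simp add: g_def)
  also have "\<dots> \<le> (\<integral>\<^sup>+u\<in>{0<..<1}. ennreal (trunc_moment (card S) (u * T) / u) \<partial>lborel)"
  proof (intro nn_integral_mono)
    fix u :: real
    show "(\<integral>\<^sup>+A. g A u * indicator {0<..<1} u \<partial>\<mu>)
        \<le> ennreal (trunc_moment (card S) (u * T) / u) * indicator {0<..<1} u"
    proof (cases "u \<in> {0<..<1}")
      case True
      then have u: "0 < u" and uT: "0 \<le> u * T" using insert.prems by auto
      have "(\<integral>\<^sup>+A. g A u \<partial>\<mu>) = (\<integral>\<^sup>+A. min (P A) (ennreal (u * T)) * inverse (ennreal u) \<partial>\<mu>)"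
        unfolding g_def using u insert.prems by (simp add: min_mult_inverse_ennreal)
      also have "\<dots> = (\<integral>\<^sup>+A. min (P A) (ennreal (u * T)) \<partial>\<mu>) * inverse (ennreal u)"
        by (rule nn_integral_multc) measurable
      also have "\<dots> \<le> ennreal (trunc_moment (card S) (u * T)) * inverse (ennreal u)"
        using insert.IH[OF uT] unfolding P_def by (rule mult_right_mono) simp
      also have "\<dots> = ennreal (trunc_moment (card S) (u * T) / u)"
        using u trunc_moment_nonneg[OF uT]
        by (simp add: inverse_ennreal divide_inverse ennreal_mult)
      finally show ?thesis using True by simp
    qed simp
  qed
  also have "\<dots> = ennreal (trunc_moment (Suc (card S)) T)"
    by (rule nn_integral_trunc_moment[OF insert.prems])
  finally show ?case
    using insert.hyps by (simp add: f_def P_def mult.commute)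
qed

section \<open>Markov's inequality for the truncated sum\<close>

theorem theorem1p3:
  fixes X :: "(int^'n) set"
    and \<epsilon> :: real
    and \<mu> :: "(circle^'n^'m) measure"
  assumes haar: "normalized_haar \<mu>"
    and X: "finite X" "X \<noteq> {}"
    and eps: "0 < \<epsilon>" "\<epsilon> < 1"
  shows "\<exists>E\<in>sets \<mu>. emeasure \<mu> E \<le> ennreal \<epsilon> \<and>
    (\<forall>A. A \<notin> E \<longrightarrow>
      (\<Sum>\<xi>\<in>X - {0}. prodF (mat_apply A \<xi>))
        \<le> ennreal (8 ^ CARD('m) * inverse \<epsilon> * real (card X) *
            (\<Sum>m=0..CARD('m). (ln (inverse \<epsilon> * real (card X))) ^ m / fact m)))"
proof -
  define Y where "Y = inverse \<epsilon> * real (card X)"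
  define g where "g = exp_trunc CARD('m) (ln Y)"
  define B where "B = 8 ^ CARD('m) * Y * g"
  have sets: "sets \<mu> = sets borel" and sp: "space \<mu> = UNIV"
    using haar sets_eq_imp_space_eq[of \<mu> borel] by (auto simp: normalized_haar_def)
  note circle_norm_mat_apply_measurable[OF sets, measurable]
  have Fm [measurable]: "(\<lambda>A. prodF (mat_apply A \<xi>)) \<in> borel_measurable \<mu>" for \<xi>
    unfolding prodF_def by measurable
  have "0 < card X" using X by (simp add: card_gt_0_iff)
  then have X1: "1 \<le> real (card X)" by simp
  moreover have "1 < inverse \<epsilon>" using eps by (simp add: one_less_inverse)
  moreover have "inverse \<epsilon> * 1 \<le> inverse \<epsilon> * real (card X)"
    using X1 eps by (intro mult_left_mono) auto
  ultimately have Y: "1 < Y" unfolding Y_def by linarith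
  then have g1: "1 \<le> g" unfolding g_def by (intro exp_trunc_ge_1) simp
  have "1 < B"
  proof -
    have "1 \<le> (8::real) ^ CARD('m) * g" using g1 mult_mono[of 1 "8 ^ CARD('m)" 1 g] by simp
    then have "Y * 1 \<le> Y * (8 ^ CARD('m) * g)" using Y by (intro mult_left_mono) auto
    also have "Y * (8 ^ CARD('m) * g) = B" by (simp add: B_def)
    finally show ?thesis using Y by simp
  qed
  have goal_B: "8 ^ CARD('m) * inverse \<epsilon> * real (card X) *
      (\<Sum>m=0..CARD('m). (ln (inverse \<epsilon> * real (card X))) ^ m / fact m) = B"
    by (simp add: B_def g_def Y_def exp_trunc_def mult.assoc)
  define h where "h A = (\<Sum>\<xi>\<in>X - {0}. min (prodF (mat_apply A \<xi>)) (ennreal B))" for A :: "circle^'n^'m"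
  define E where "E = {A \<in> space \<mu>. ennreal B < (\<Sum>\<xi>\<in>X - {0}. prodF (mat_apply A \<xi>))}"
  have hm [measurable]: "h \<in> borel_measurable \<mu>" unfolding h_def by measurable
  have E: "E \<in> sets \<mu>" unfolding E_def by measurable
  \<comment> \<open>A single term above \<open>B\<close> already contributes \<open>B\<close> after
    truncation; if there is none, truncation changes nothing.\<close>
  have "ennreal B \<le> h A" if "A \<in> E" for A
  proof (cases "\<exists>\<xi>\<in>X - {0}. ennreal B < prodF (mat_apply A \<xi>)")
    case True
    then obtain \<xi> where \<xi>: "\<xi> \<in> X - {0}" "ennreal B < prodF (mat_apply A \<xi>)" by blast
    then have "ennreal B = min (prodF (mat_apply A \<xi>)) (ennreal B)"
      by (simp add: min_absorb2 less_imp_le)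
    also have "\<dots> \<le> h A"
      unfolding h_def
      using member_le_sum[OF \<xi>(1), of "\<lambda>\<xi>. min (prodF (mat_apply A \<xi>)) (ennreal B)"] X(1)
      by simp
    finally show ?thesis .
  next
    case False
    then have "h A = (\<Sum>\<xi>\<in>X - {0}. prodF (mat_apply A \<xi>))"
      unfolding h_def by (intro sum.cong) (auto simp: min_def not_less)
    with that show ?thesis by (simp add: E_def less_imp_le)
  qed
  then have "ennreal B * emeasure \<mu> E \<le> (\<integral>\<^sup>+A. h A \<partial>\<mu>)"
    using E by (subst nn_integral_cmult_indicator[symmetric])
      (auto intro!: nn_integral_mono simp: indicator_def)
  also have "\<dots> = (\<Sum>\<xi>\<in>X - {0}. \<integral>\<^sup>+A. min (prodF (mat_apply A \<xi>)) (ennreal B) \<partial>\<mu>)"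
    unfolding h_def by (rule nn_integral_sum) measurable
  also have "\<dots> \<le> (\<Sum>\<xi>\<in>X - {0}. ennreal (trunc_moment CARD('m) B))"
    using nn_integral_min_prod_le[OF haar, of _ B UNIV] \<open>1 < B\<close>
    by (intro sum_mono) (simp add: prodF_def)
  \<comment> \<open>The sum is enlarged to all of \<open>X\<close>, so that the number of terms is
    the factor \<open>card X\<close> contained in \<open>Y\<close>.\<close>
  also have "\<dots> \<le> (\<Sum>\<xi>\<in>X. ennreal (trunc_moment CARD('m) B))"
    using X by (intro sum_mono2) auto
  \<comment> \<open>As \<open>B > 1\<close>, \<open>trunc_moment\<close> is the series at
    \<open>ln B\<close>, and \<open>exp_trunc_ln_le\<close> returns to \<open>ln Y\<close>.\<close>
  also have "\<dots> \<le> (\<Sum>\<xi>\<in>X. ennreal (8 ^ CARD('m) * g))"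
    using \<open>1 < B\<close> Y exp_trunc_ln_le[of Y "CARD('m)"]
    by (intro sum_mono ennreal_leI) (simp add: trunc_moment_def B_def g_def)
  also have "\<dots> = ennreal (real (card X) * (8 ^ CARD('m) * g))"
    using g1 by (simp add: ennreal_of_nat_eq_real_of_nat ennreal_mult)
  \<comment> \<open>Since \<open>Y\<close> is |X| / \<epsilon>, the bound is exactly \<epsilon>
    times \<open>B\<close>, and the finite positive \<open>B\<close> cancels.\<close>
  also have "real (card X) * (8 ^ CARD('m) * g) = B * \<epsilon>"
    using eps by (simp add: B_def Y_def field_simps)
  also have "ennreal (B * \<epsilon>) = ennreal B * ennreal \<epsilon>"
    using \<open>1 < B\<close> eps by (simp add: ennreal_mult)
  finally have "emeasure \<mu> E \<le> ennreal \<epsilon>"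
    using \<open>1 < B\<close> by (simp add: ennreal_mult_le_mult_iff)
  moreover have "(\<Sum>\<xi>\<in>X - {0}. prodF (mat_apply A \<xi>)) \<le> ennreal B" if "A \<notin> E" for A
    using that by (simp add: E_def sp not_less)
  ultimately show ?thesis
    unfolding goal_B using E by blast
qed

end
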